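(* A $14$-tuple $(a,b,c,d,e,f,g,h,i,j,k,l,m,n)$ equals $$(y_{1,0},y_{2,0},y_{3,0},y_{4,0},\;y_{1,1},y_{2,1},y_{3,1},y_{4,1},\;y_{1,2},y_{2,2},y_{3,2},\;y_{1,3},y_{2,3},\;y_{1,4})$$ for some arithmetic Y-frieze pattern $(y_{i,j})$ of width $4$ if and only if it is one of the following $42$ tuples: (1,1,2,3,2,9,20,7,5,14,6,3,2,1), (1,1,4,5,2,15,24,5,8,15,4,2,1,1), (1,2,3,2,3,8,9,5,3,5,4,2,3,2), (1,2,3,4,3,8,15,4,3,8,3,3,2,1), (1,2,6,7,3,14,20,3,5,9,2,2,1,1), (1,2,9,5,3,20,14,3,7,6,2,1,1,2), (1,3,8,3,4,15,8,3,4,3,2,1,2,3), (1,4,5,3,5,9,8,3,2,3,2,2,3,2), (1,4,15,8,5,24,15,2,5,4,1,1,1,2), (1,6,14,5,7,20,9,2,3,2,1,1,2,3), (2,1,1,2,1,4,15,8,5,24,15,5,4,1), (2,1,2,3,1,6,14,5,7,20,9,3,2,1), (2,3,2,1,2,3,4,5,2,5,9,3,8,3), (2,3,2,3,2,3,8,3,2,9,5,5,4,1), (2,3,4,5,2,5,9,2,3,8,3,3,2,1), (2,3,8,3,2,9,5,2,5,4,3,1,2,3), (2,5,9,2,3,8,3,2,3,2,3,1,4,5), (2,9,5,2,5,4,3,2,1,2,3,3,8,3), (2,9,20,7,5,14,6,1,3,2,1,1,2,3), (2,15,24,5,8,15,4,1,2,1,1,1,4,5), (3,2,1,1,1,2,6,7,3,14,20,5,9,2),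 (3,2,1,2,1,2,9,5,3,20,14,7,6,1), (3,2,2,3,1,3,8,3,4,15,8,4,3,1), (3,2,3,2,1,4,5,3,5,9,8,2,3,2), (3,5,4,1,2,3,2,3,2,3,8,2,9,5), (3,8,3,1,3,2,2,3,1,3,8,4,15,4), (3,8,3,2,3,2,3,2,1,4,5,5,9,2), (3,8,9,5,3,5,4,1,2,3,2,2,3,2), (3,8,15,4,3,8,3,1,3,2,2,1,3,4), (3,14,20,3,5,9,2,1,2,1,2,1,6,7), (3,20,14,3,7,6,2,1,1,1,2,2,9,5), (4,3,2,1,1,2,3,4,3,8,15,3,8,3), (4,15,8,3,4,3,2,1,1,2,3,3,8,3), (5,4,1,1,1,1,4,5,2,15,24,8,15,2), (5,4,3,2,1,2,3,2,3,8,9,3,5,2), (5,9,2,1,2,1,2,3,1,6,14,7,20,3), (5,9,8,3,2,3,2,1,2,3,4,2,5,3), (5,14,6,1,3,2,1,2,1,2,9,3,20,7), (5,24,15,2,5,4,1,1,1,1,4,2,15,8), (7,6,2,1,1,1,2,3,2,9,20,5,14,3), (7,20,9,2,3,2,1,1,1,2,6,3,14,5), (8,15,4,1,2,1,1,2,1,4,15,5,24,5).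
   Context: A Y-frieze pattern of width $n$ is an array of rational numbers $y_{i,j}$, $i=0,1,\dots,n+1$, $j\in\mathbb{Z}$, arranged in staggered rows (entry $y_{i,j}$ placed at horizontal position $j+i/2$ in row $i$), such that row $0$ and row $n+1$ consist entirely of $0$'s, no row strictly between them consists entirely of $0$'s, and the Y-diamond rule $WE=(1+N)(1+S)$ holds for every diamond, i.e. $y_{i,j}\,y_{i,j+1}=(1+y_{i-1,j+1})(1+y_{i+1,j})$ for $1\le i\le n$, $j\in\mathbb{Z}$. It is arithmetic if all entries in rows $1,\dots,n$ (its non-zero entries) are positive integers. For width $4$, the listed $14$ entries form a fundamental domain of the glide symmetry of the pattern. *)

theory Defs
  imports Complex_Main
begin

text \<open>
  An array is a function \<open>y i j\<close> of the row \<open>i\<close> and the index \<open>j\<close> within the row; only the rows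
  \<open>0, \<dots>, n + 1\<close> belong to the pattern, values in rows beyond \<open>n + 1\<close> are irrelevant.
  The entry \<open>y i j\<close> sits at horizontal position \<open>j + i/2\<close>, so the diamond with West entry \<open>y i j\<close> and
  East entry \<open>y i (j + 1)\<close> has North entry \<open>y (i - 1) (j + 1)\<close> and South entry \<open>y (i + 1) j\<close>; the
  Y-diamond rule is \<open>W E = (1 + N) (1 + S)\<close>.
\<close>

definition Y_frieze_pattern :: "nat \<Rightarrow> (nat \<Rightarrow> int \<Rightarrow> rat) \<Rightarrow> bool" where
  "Y_frieze_pattern n y \<longleftrightarrow>
     (\<forall>j. y 0 j = 0) \<and> (\<forall>j. y (n + 1) j = 0) \<and>
     (\<forall>i\<in>{1..n}. \<exists>j. y i j \<noteq> 0) \<and>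
     (\<forall>i\<in>{1..n}. \<forall>j. y i j * y i (j + 1) = (1 + y (i - 1) (j + 1)) * (1 + y (i + 1) j))"

definition arithmetic_Y_frieze_pattern :: "nat \<Rightarrow> (nat \<Rightarrow> int \<Rightarrow> rat) \<Rightarrow> bool" where
  "arithmetic_Y_frieze_pattern n y \<longleftrightarrow>
     Y_frieze_pattern n y \<and> (\<forall>i\<in>{1..n}. \<forall>j. y i j \<in> \<int> \<and> y i j > 0)"

end

theory Submission
  imports Defs
begin

(* A Y-frieze pattern of width 4 is invariant under a glide reflection, so it is given by its first
   two rows u, v, which are 7-periodic and satisfy u_j u_(j+1) = 1 + v_j and
   v_j v_(j+1) = (1 + u_(j+1)) (1 + v_(j+4)).  Put A_j = v_(j-1) / u_(j+3), the first row of a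
   Coxeter frieze with A_j A_(j+1) = 1 + u_j and A_j + A_(j+2) = A_j A_(j+1) A_(j+2) - u_(j+4).
   The second relation makes A_j an integral affine function of A_(j+2), hence, 7 being odd, of
   A_(j+1); as A_j A_(j+1) is an integer, A_j is a root of a monic integral quadratic, so it is an
   integer.  Now 1, A_0, u_0, u_4, A_5, 1 is a diagonal of the Coxeter frieze: each interior entry
   divides the sum of its neighbours.  By convexity either all entries are 1 or some entry equals
   the sum of its neighbours and can be removed, which leaves 42 diagonals. *)

section \<open>Integrality and divisibility\<close>

text \<open>Clearing denominators makes the reduced denominator \<open>q\<close> divide
  \<open>p * p\<close>, hence \<open>p\<close>, so coprimality forces \<open>q = 1\<close>.\<close>

lemma Ints_if_monic_quadratic_root:
  fixes x :: rat
  assumes "s \<in> \<int>" "t \<in> \<int>" "x * x = s * x + t"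
  shows "x \<in> \<int>"
proof -
  obtain p q where pq: "quotient_of x = (p, q)" by (cases "quotient_of x")
  have q: "q > 0" and cop: "coprime p q" and x: "x = of_int p / of_int q"
    using pq quotient_of_denom_pos quotient_of_coprime quotient_of_div by blast+
  obtain s' t' where s': "s = of_int s'" and t': "t = of_int t'"
    using assms(1,2) by (auto elim!: Ints_cases)
  have "(of_int (p * p) :: rat) = of_int (s' * p * q + t' * q * q)"
    using assms(3) q unfolding x s' t' by (simp add: field_simps)
  then have "p * p = q * (s' * p + t' * q)"
    by (simp only: of_int_eq_iff) (simp add: algebra_simps)
  then have "q dvd p * p" by simp
  then have "q dvd p" using cop by (simp add: coprime_commute coprime_dvd_mult_left_iff)
  then have "q = 1" using cop q by (metis coprime_common_divisor dvd_refl zdvd1_eq abs_of_pos)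
  then show ?thesis using x by simp
qed

text \<open>The quotient is 1 or at least 2. For an entry of a chain this separates being the sum of
  its neighbours from a convexity inequality.\<close>

lemma dvd_imp_eq_or_double_le:
  fixes x y :: int
  assumes "x dvd y" "x > 0" "y > 0"
  shows "x = y \<or> 2 * x \<le> y"
proof -
  obtain k where k: "y = x * k" using assms(1) ..
  then have "k > 0" using assms by (simp add: zero_less_mult_iff)
  then have "k = 1 \<or> 2 \<le> k" by linarith
  then show ?thesis using k assms(2) by (auto simp: mult.commute)
qed

text \<open>Serves to delete from a chain an entry that is the sum of its neighbours: for a
  neighbour \<open>x\<close> of it, replacing that entry by its other neighbour subtracts
  \<open>x\<close> from the sum that \<open>x\<close> divides.\<close>

lemma dvd_add_cancel:
  fixes x y z :: int
  assumes "x dvd z" "z = x + y"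
  shows "x dvd y"
  using assms by simp

section \<open>Chains bordered by 1 whose entries divide the sum of their neighbours\<close>

text \<open>An entry equal to the sum of its neighbours is deleted, leaving a single entry that
  divides \<open>1 + 1\<close>; reinserting the sum gives the list.\<close>

lemma divisor_chain_2:
  fixes p q :: int
  assumes pos: "p > 0" "q > 0"
    and dvd: "p dvd 1 + q" "q dvd p + 1"
  shows "(p, q) \<in>
     {(1, 1), (1, 2), (2, 1), (2, 3), (3, 2)}"
proof -
  consider "p = 1 + q" | "q = p + 1"
    | "2 * p \<le> 1 + q" "2 * q \<le> p + 1"
    using pos dvd[THEN dvd_imp_eq_or_double_le] by force
  then show ?thesis
  proof cases
    case 1
    have *: "q dvd 1 + 1" by (rule dvd_add_cancel[OF dvd(2)]) (use 1 in simp)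
    have "q \<in> {1, 2}" using zdvd_imp_le[OF *] pos by auto
    then show ?thesis using 1 by auto
  next
    case 2
    have *: "p dvd 1 + 1" by (rule dvd_add_cancel[OF dvd(1)]) (use 2 in simp)
    have "p \<in> {1, 2}" using zdvd_imp_le[OF *] pos by auto
    then show ?thesis using 2 by auto
  next
    \<comment> \<open>The sequence 1, \<open>p\<close>, \<open>q\<close>, 1 is convex here, so no
      entry exceeds the end value 1.\<close>
    case 3
    then have "p = 1" "q = 1" using pos by linarith+
    then show ?thesis by simp
  qed
qed

text \<open>The same deletion reduces to the five chains of length 2.\<close>

lemma divisor_chain_3:
  fixes p q r :: int
  assumes pos: "p > 0" "q > 0" "r > 0"
    and dvd: "p dvd 1 + q" "q dvd p + r" "r dvd q + 1"
  shows "(p, q, r) \<in>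
     {(1, 1, 1), (1, 1, 2), (1, 2, 1), (1, 2, 3), (1, 3, 2), (2, 1, 1), (2, 1, 2), (2, 3, 1),
      (2, 3, 4), (2, 5, 3), (3, 2, 1), (3, 2, 3), (3, 5, 2), (4, 3, 2)}"
proof -
  consider "p = 1 + q" | "q = p + r" | "r = q + 1"
    | "2 * p \<le> 1 + q" "2 * q \<le> p + r" "2 * r \<le> q + 1"
    using pos dvd[THEN dvd_imp_eq_or_double_le] by force
  then show ?thesis
  proof cases
    case 1
    have *: "q dvd 1 + r" by (rule dvd_add_cancel[OF dvd(2)]) (use 1 in simp)
    show ?thesis
      using divisor_chain_2[OF pos(2,3) * dvd(3)] 1 by (elim insertE emptyE) simp_all
  next
    case 2
    have *: "p dvd 1 + r" by (rule dvd_add_cancel[OF dvd(1)]) (use 2 in simp)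
    have **: "r dvd p + 1" by (rule dvd_add_cancel[OF dvd(3)]) (use 2 in simp)
    show ?thesis
      using divisor_chain_2[OF pos(1,3) * **] 2 by (elim insertE emptyE) simp_all
  next
    case 3
    have *: "q dvd p + 1" by (rule dvd_add_cancel[OF dvd(2)]) (use 3 in simp)
    show ?thesis
      using divisor_chain_2[OF pos(1,2) dvd(1) *] 3 by (elim insertE emptyE) simp_all
  next
    case 4
    then have "p = 1" "q = 1" "r = 1" using pos by linarith+
    then show ?thesis by simp
  qed
qed

text \<open>Deletion now leads to length 3. The list lengths 5, 14, 42 are the Catalan numbers that
  count triangulations of a pentagon, a hexagon and a heptagon.\<close>

lemma divisor_chain_4:
  fixes p q r s :: int
  assumes pos: "p > 0" "q > 0" "r > 0" "s > 0"
    and dvd: "p dvd 1 + q" "q dvd p + r" "r dvd q + s" "s dvd r + 1"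
  shows "(p, q, r, s) \<in>
     {(1, 1, 1, 1), (1, 1, 1, 2), (1, 1, 2, 1), (1, 1, 2, 3), (1, 1, 3, 2), (1, 2, 1, 1),
      (1, 2, 1, 2), (1, 2, 3, 1), (1, 2, 3, 4), (1, 2, 5, 3), (1, 3, 2, 1), (1, 3, 2, 3),
      (1, 3, 5, 2), (1, 4, 3, 2), (2, 1, 1, 1), (2, 1, 1, 2), (2, 1, 2, 1), (2, 1, 2, 3),
      (2, 1, 3, 2), (2, 3, 1, 1), (2, 3, 1, 2), (2, 3, 4, 1), (2, 3, 4, 5), (2, 3, 7, 4),
      (2, 5, 3, 1), (2, 5, 3, 4), (2, 5, 8, 3), (2, 7, 5, 3), (3, 2, 1, 1), (3, 2, 1, 2),
      (3, 2, 3, 1), (3, 2, 3, 4), (3, 2, 5, 3), (3, 5, 2, 1), (3, 5, 2, 3), (3, 5, 7, 2),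
      (3, 8, 5, 2), (4, 3, 2, 1), (4, 3, 2, 3), (4, 3, 5, 2), (4, 7, 3, 2), (5, 4, 3, 2)}"
proof -
  consider "p = 1 + q" | "q = p + r" | "r = q + s" | "s = r + 1"
    | "2 * p \<le> 1 + q" "2 * q \<le> p + r" "2 * r \<le> q + s" "2 * s \<le> r + 1"
    using pos dvd[THEN dvd_imp_eq_or_double_le] by force
  then show ?thesis
  proof cases
    case 1
    have *: "q dvd 1 + r" by (rule dvd_add_cancel[OF dvd(2)]) (use 1 in simp)
    show ?thesis
      using divisor_chain_3[OF pos(2,3,4) * dvd(3) dvd(4)] 1 by (elim insertE emptyE) simp_all
  next
    case 2
    have *: "p dvd 1 + r" by (rule dvd_add_cancel[OF dvd(1)]) (use 2 in simp)
    have **: "r dvd p + s" by (rule dvd_add_cancel[OF dvd(3)]) (use 2 in simp)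
    show ?thesis
      using divisor_chain_3[OF pos(1,3,4) * ** dvd(4)] 2 by (elim insertE emptyE) simp_all
  next
    case 3
    have *: "q dvd p + s" by (rule dvd_add_cancel[OF dvd(2)]) (use 3 in simp)
    have **: "s dvd q + 1" by (rule dvd_add_cancel[OF dvd(4)]) (use 3 in simp)
    show ?thesis
      using divisor_chain_3[OF pos(1,2,4) dvd(1) * **] 3 by (elim insertE emptyE) simp_all
  next
    case 4
    have *: "r dvd q + 1" by (rule dvd_add_cancel[OF dvd(3)]) (use 4 in simp)
    show ?thesis
      using divisor_chain_3[OF pos(1,2,3) dvd(1) dvd(2) *] 4 by (elim insertE emptyE) simp_all
  next
    case 5
    then have "p = 1" "q = 1" "r = 1" "s = 1" using pos by linarith+
    then show ?thesis by simp
  qed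
qed

section \<open>Glide symmetry\<close>

text \<open>Here \<open>a\<close>, \<open>b\<close>, \<open>c\<close>, \<open>d\<close> is one
  diagonal of the pattern; \<open>e\<close>, \<open>f\<close>, \<open>g\<close>, \<open>h\<close>
  and \<open>i\<close>, \<open>j\<close>, \<open>k\<close> start the next two. All later entries are
  rational functions of the first diagonal, and positivity keeps the denominators nonzero.\<close>

lemma glide_identity:
  fixes a b c d :: "'a :: linordered_field"
  assumes pos: "a > 0" "b > 0" "c > 0" "d > 0" "e > 0" "f > 0" "g > 0"
    and eqs: "a * e = 1 + b" "b * f = (1 + e) * (1 + c)" "c * g = (1 + f) * (1 + d)"
      "d * h = 1 + g" "e * i = 1 + f" "f * j = (1 + i) * (1 + g)" "g * k = (1 + j) * (1 + h)"
  shows "a * h = 1 + k"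
proof -
  \<comment> \<open>\<open>S\<close>, \<open>T\<close>, \<open>W\<close> are the numerators of
    \<open>1 + e\<close>, \<open>1 + f\<close>, \<open>1 + g\<close>; \<open>Z\<close> is the new
    factor of \<open>1 + j\<close> and of \<open>k\<close>. The sums \<open>1 + i\<close> and
    \<open>1 + j\<close> factor so that \<open>S\<close> and \<open>T\<close> cancel on division by
    \<open>f\<close> and \<open>g\<close>.\<close>
  define S where "S = 1 + a + b"
  define T where "T = a * b + S * (1 + c)"
  define W where "W = a * b * c + T * (1 + d)"
  define Z where "Z = b * c + (1 + d) * (1 + b + c)"
  have S: "S > 0" and T: "T > 0"
    using pos by (auto simp: S_def T_def intro!: add_pos_pos mult_pos_pos)
  have nz: "a \<noteq> 0" "b \<noteq> 0" "c \<noteq> 0" "d \<noteq> 0" "e \<noteq> 0" "f \<noteq> 0" "g \<noteq> 0"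
    "1 + b \<noteq> 0" "1 + c \<noteq> 0" "1 + d \<noteq> 0" "S \<noteq> 0" "T \<noteq> 0"
    using pos S T by auto
  have e: "e = (1 + b) / a" using eqs(1) nz by (simp add: field_simps)
  have e1: "1 + e = S / a" unfolding e S_def using nz by (simp add: field_simps)
  have f: "f = S * (1 + c) / (a * b)" using eqs(2) nz unfolding e1 by (simp add: field_simps)
  have f1: "1 + f = T / (a * b)" unfolding f T_def using nz by (simp add: field_simps)
  have g: "g = T * (1 + d) / (a * b * c)" using eqs(3) nz unfolding f1 by (simp add: field_simps)
  have g1: "1 + g = W / (a * b * c)" unfolding g W_def using nz by (simp add: field_simps)
  have h: "h = W / (a * b * c * d)" using eqs(4) nz unfolding g1 by (simp add: field_simps)
  have "a * b * c * d + W = (1 + a) * (1 + b) * (1 + c) * (1 + d)"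
    unfolding W_def T_def S_def by (simp add: algebra_simps)
  then have h1: "1 + h = (1 + a) * (1 + b) * (1 + c) * (1 + d) / (a * b * c * d)"
    unfolding h using nz by (simp add: field_simps)
  have i: "i = T / (b * (1 + b))"
  proof -
    have "e * i = T / (a * b)" using eqs(5) f1 by simp
    also have "\<dots> = e * (T / (b * (1 + b)))"
      unfolding e using nz by (simp add: divide_simps)
    finally show ?thesis unfolding mult_left_cancel[OF nz(5)] .
  qed
  have "b * (1 + b) + T = S * (1 + b + c)"
    unfolding T_def S_def by (simp add: algebra_simps)
  then have i1: "1 + i = S * (1 + b + c) / (b * (1 + b))"
    unfolding i using nz by (simp add: add_divide_eq_iff)
  have j: "j = (1 + b + c) * W / (b * c * (1 + b) * (1 + c))"
  proof -
    have "f * j = S * (1 + b + c) / (b * (1 + b)) * (W / (a * b * c))"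
      unfolding eqs(6) i1 g1 ..
    also have "\<dots> = f * ((1 + b + c) * W / (b * c * (1 + b) * (1 + c)))"
      unfolding f using nz by (simp add: divide_simps)
    finally show ?thesis unfolding mult_left_cancel[OF nz(6)] .
  qed
  have "b * c * (1 + b) * (1 + c) + (1 + b + c) * W = T * Z"
    unfolding W_def T_def S_def Z_def by (simp add: algebra_simps)
  then have j1: "1 + j = T * Z / (b * c * (1 + b) * (1 + c))"
    unfolding j using nz by (simp add: add_divide_eq_iff)
  have k: "k = Z * (1 + a) / (b * c * d)"
  proof -
    have "g * k = T * Z / (b * c * (1 + b) * (1 + c))
        * ((1 + a) * (1 + b) * (1 + c) * (1 + d) / (a * b * c * d))"
      unfolding eqs(7) j1 h1 ..
    also have "\<dots> = g * (Z * (1 + a) / (b * c * d))"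
      unfolding g using nz by (simp add: divide_simps)
    finally show ?thesis unfolding mult_left_cancel[OF nz(7)] .
  qed
  have "W = b * c * d + Z * (1 + a)"
    unfolding W_def T_def S_def Z_def by (simp add: algebra_simps)
  then show ?thesis unfolding k h using nz by (simp add: field_simps)
qed

lemma arithmetic_Y_frieze_pattern_4_iff:
  "arithmetic_Y_frieze_pattern 4 y \<longleftrightarrow>
     (\<forall>j. y 0 j = 0) \<and> (\<forall>j. y 5 j = 0) \<and>
     (\<forall>j. y 1 j * y 1 (j + 1) = 1 + y 2 j) \<and>
     (\<forall>j. y 2 j * y 2 (j + 1) = (1 + y 1 (j + 1)) * (1 + y 3 j)) \<and>
     (\<forall>j. y 3 j * y 3 (j + 1) = (1 + y 2 (j + 1)) * (1 + y 4 j)) \<and>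
     (\<forall>j. y 4 j * y 4 (j + 1) = 1 + y 3 (j + 1)) \<and>
     (\<forall>i\<in>{1,2,3,4}. \<forall>j. y i j \<in> \<int> \<and> y i j > 0)"
proof -
  have 1: "{1..4::nat} = {1,2,3,4}" by auto
  show ?thesis
    unfolding arithmetic_Y_frieze_pattern_def Y_frieze_pattern_def 1
    by (auto simp: numeral_eq_Suc) (metis less_irrefl)+
qed

lemma glide_symmetry:
  assumes "arithmetic_Y_frieze_pattern 4 y"
  shows "y 4 (j + 2) = y 1 j" "y 3 (j + 3) = y 2 j" "y 2 (j + 4) = y 3 j" "y 1 (j + 5) = y 4 j"
proof -
  note A = assms[unfolded arithmetic_Y_frieze_pattern_4_iff]
  have r1: "y 1 j * y 1 (j + 1) = 1 + y 2 j" for j using A by blast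
  have r2: "y 2 j * y 2 (j + 1) = (1 + y 1 (j + 1)) * (1 + y 3 j)" for j using A by blast
  have r3: "y 3 j * y 3 (j + 1) = (1 + y 2 (j + 1)) * (1 + y 4 j)" for j using A by blast
  have r4: "y 4 j * y 4 (j + 1) = 1 + y 3 (j + 1)" for j using A by blast
  have pos: "y 1 j > 0" "y 2 j > 0" "y 3 j > 0" "y 4 j > 0" for j using A by auto
  have nz: "y 1 j \<noteq> 0" "y 2 j \<noteq> 0" "y 3 j \<noteq> 0" "y 4 j \<noteq> 0"
    "1 + y 1 j \<noteq> 0" "1 + y 2 j \<noteq> 0" "1 + y 3 j \<noteq> 0" "1 + y 4 j \<noteq> 0" for j
    using pos[of j] by linarith+
  have g4: "y 4 (j + 2) = y 1 j" for j
  proof -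
    have "y 1 (j + 1) * y 1 (j + 2) = 1 + y 2 (j + 1)"
      "y 2 (j + 1) * y 2 (j + 2) = (1 + y 1 (j + 2)) * (1 + y 3 (j + 1))"
      "y 3 (j + 1) * y 3 (j + 2) = (1 + y 2 (j + 2)) * (1 + y 4 (j + 1))"
      using r1[of "j + 1"] r2[of "j + 1"] r3[of "j + 1"] by (simp_all add: add.assoc)
    then have "y 1 j * y 4 (j + 1) = 1 + y 3 (j + 2)"
      by (rule glide_identity[OF pos(1) pos(2) pos(3) pos(4) pos(1) pos(2) pos(3) r1 r2 r3 r4])
    \<comment> \<open>The last row has the same right-hand side in its diamond rule, so the common
      factor \<open>y 4 (j + 1)\<close> cancels.\<close>
    also have "\<dots> = y 4 (j + 2) * y 4 (j + 1)"
      using r4[of "j + 1"] by (simp add: add.assoc mult.commute)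
    finally show ?thesis using nz by simp
  qed
  \<comment> \<open>From here upwards, each row is recovered by solving a diamond rule for its North
    entry and comparing with the mirrored rule.\<close>
  have g3: "y 3 (j + 3) = y 2 j" for j
    using r4[of "j + 2"] g4[of j] g4[of "j + 1"] r1[of j] by (simp add: add.assoc add.commute)
  have g2: "y 2 (j + 4) = y 3 j" for j
    using r3[of "j + 3"] g3[of j] g3[of "j + 1"] g4[of "j + 1"] r2[of j] nz(5)[of "j + 1"]
    by (simp add: add.assoc add.commute)
  have g1: "y 1 (j + 5) = y 4 j" for j
    using r2[of "j + 4"] g2[of j] g2[of "j + 1"] g3[of "j + 1"] r3[of j] nz(6)[of "j + 1"]
    by (simp add: add.assoc add.commute)
  show "y 4 (j + 2) = y 1 j" "y 3 (j + 3) = y 2 j" "y 2 (j + 4) = y 3 j" "y 1 (j + 5) = y 4 j"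
    by (fact g4 g3 g2 g1)+
qed

lemma eq_mem_trans: "x = y \<Longrightarrow> y \<in> X \<Longrightarrow> x \<in> X"
  by simp

section \<open>Patterns built from 7-periodic rows\<close>

lemma mod_7_cases:
  fixes j :: int
  obtains "j mod 7 = 0" | "j mod 7 = 1" | "j mod 7 = 2" | "j mod 7 = 3"
    | "j mod 7 = 4" | "j mod 7 = 5" | "j mod 7 = 6"
  by linarith

text \<open>The fourteen equations are the relations between the first two rows over one full
  period, with the entries of rows 3 and 4 moved there by the glide.\<close>

lemma arithmetic_Y_frieze_pattern_4_exI:
  fixes a b c d e f g h i j k l m n :: rat
  assumes eqs: "a * e = 1 + b" "e * i = 1 + f" "i * l = 1 + j" "l * n = 1 + m" "n * d = 1 + c"
      "d * h = 1 + g" "h * a = 1 + k"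
      "b * f = (1 + e) * (1 + c)" "f * j = (1 + i) * (1 + g)" "j * m = (1 + l) * (1 + k)"
      "m * c = (1 + n) * (1 + b)" "c * g = (1 + d) * (1 + f)" "g * k = (1 + h) * (1 + j)"
      "k * b = (1 + a) * (1 + m)"
    and ints: "{a, b, c, d, e, f, g, h, i, j, k, l, m, n} \<subseteq> {x \<in> \<int>. x > 0}"
  shows "\<exists>y. arithmetic_Y_frieze_pattern 4 y \<and>
            (a, b, c, d, e, f, g, h, i, j, k, l, m, n) =
            (y 1 0, y 2 0, y 3 0, y 4 0, y 1 1, y 2 1, y 3 1, y 4 1,
             y 1 2, y 2 2, y 3 2, y 1 3, y 2 3, y 1 4)"
proof -
  \<comment> \<open>After the entries listed from row 1 come \<open>d\<close> and \<open>h\<close>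
    of row 4, at positions 5 and 6; likewise \<open>v\<close> ends with \<open>c\<close>,
    \<open>g\<close>, \<open>k\<close> of row 3, at positions 4, 5, 6.\<close>
  define u where "u t = [a, e, i, l, n, d, h] ! nat (t mod 7)" for t :: int
  define v where "v t = [b, f, j, m, c, g, k] ! nat (t mod 7)" for t :: int
  have u: "u t * u (t + 1) = 1 + v t" for t
    by (cases t rule: mod_7_cases)
       (simp_all add: u_def v_def mod_add_left_eq[of t 7, symmetric] eqs)
  have v: "v t * v (t + 1) = (1 + u (t + 1)) * (1 + v (t + 4))" for t
    by (cases t rule: mod_7_cases)
       (simp_all add: u_def v_def mod_add_left_eq[of t 7, symmetric] eqs)
  have per: "v (t + 7) = v t" for t by (simp add: v_def)
  have int: "u t \<in> \<int> \<and> u t > 0" "v t \<in> \<int> \<and> v t > 0" for t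
    using ints by (cases t rule: mod_7_cases; simp add: u_def v_def)+
  define y where "y r t = (if r = 1 then u t else if r = 2 then v t else if r = 3 then v (t + 4)
    else if r = 4 then u (t + 5) else 0)" for r :: nat and t
  have "arithmetic_Y_frieze_pattern 4 y"
    unfolding arithmetic_Y_frieze_pattern_4_iff
  proof (intro conjI allI ballI)
    fix t
    show "y 1 t * y 1 (t + 1) = 1 + y 2 t" using u[of t] by (simp add: y_def)
    show "y 2 t * y 2 (t + 1) = (1 + y 1 (t + 1)) * (1 + y 3 t)" using v[of t] by (simp add: y_def)
    show "y 3 t * y 3 (t + 1) = (1 + y 2 (t + 1)) * (1 + y 4 t)"
      using v[of "t + 4"] per[of "t + 1"] by (simp add: y_def add.assoc mult.commute)
    show "y 4 t * y 4 (t + 1) = 1 + y 3 (t + 1)"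
      using u[of "t + 5"] by (simp add: y_def add.assoc)
  qed (use int in \<open>auto simp: y_def\<close>)
  moreover have "(a, b, c, d, e, f, g, h, i, j, k, l, m, n) =
            (y 1 0, y 2 0, y 3 0, y 4 0, y 1 1, y 2 1, y 3 1, y 4 1,
             y 1 2, y 2 2, y 3 2, y 1 3, y 2 3, y 1 4)"
    by (simp add: y_def u_def v_def)
  ultimately show ?thesis by blast
qed

section \<open>From a pattern to a diagonal of a Coxeter frieze\<close>

text \<open>The glide applied twice is translation by 7, and applied once it replaces row 3 by row
  2.\<close>

lemma arithmetic_Y_frieze_pattern_4_first_rows:
  assumes "arithmetic_Y_frieze_pattern 4 y"
  shows "y 1 t * y 1 (t + 1) = 1 + y 2 t"
    and "y 2 t * y 2 (t + 1) = (1 + y 1 (t + 1)) * (1 + y 2 (t + 4))"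
    and "y 1 (t + 7) = y 1 t" and "y 2 (t + 7) = y 2 t"
    and "y 1 t \<in> \<int>" and "y 1 t > 0" and "y 2 t > 0"
proof -
  note A = assms[unfolded arithmetic_Y_frieze_pattern_4_iff]
  show "y 1 t * y 1 (t + 1) = 1 + y 2 t" using A by blast
  show "y 2 t * y 2 (t + 1) = (1 + y 1 (t + 1)) * (1 + y 2 (t + 4))"
    using A by (simp only: glide_symmetry(3)[OF assms])
  show "y 1 (t + 7) = y 1 t"
    using glide_symmetry(1)[OF assms, of t] glide_symmetry(4)[OF assms, of "t + 2"]
    by (simp add: add.assoc)
  show "y 2 (t + 7) = y 2 t"
    using glide_symmetry(2)[OF assms, of t] glide_symmetry(3)[OF assms, of "t + 3"]
    by (simp add: add.assoc)
  show "y 1 t \<in> \<int>" "y 1 t > 0" "y 2 t > 0" using A by auto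
qed

text \<open>The last two equations are one Coxeter relation, grouped in two ways so that either
  outer entry \<open>A t\<close> or \<open>A (t + 2)\<close> can be isolated.\<close>

lemma quiddity_relations:
  fixes u v A :: "int \<Rightarrow> rat"
  assumes uv: "\<And>t. u t * u (t + 1) = 1 + v t"
      "\<And>t. v t * v (t + 1) = (1 + u (t + 1)) * (1 + v (t + 4))"
    and pos: "\<And>t. u t > 0" "\<And>t. v t > 0"
    and A: "\<And>t. A t = v (t - 1) / u (t + 3)"
  shows "A t * A (t + 1) = 1 + u t"
    and "A t + u (t + 4) = A (t + 2) * u t"
    and "A (t + 2) + u (t + 4) = A t * u (t + 1)"
proof -
  have nz: "u t \<noteq> 0" "A t \<noteq> 0" for t
    using pos(1)[of t] pos(1)[of "t + 3"] pos(2)[of "t - 1"] unfolding A by auto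
  have AA: "A t * A (t + 1) = 1 + u t" for t
  proof -
    have "v (t - 1) * v t = (1 + u t) * (u (t + 3) * u (t + 4))"
      using uv(2)[of "t - 1"] uv(1)[of "t + 3"] by (simp add: add.commute)
    then show ?thesis
      unfolding A using nz by (simp add: divide_simps add.commute)
  qed
  show "A t * A (t + 1) = 1 + u t" by (rule AA)
  have AA': "A (t + 1) * A (t + 2) = 1 + u (t + 1)" using AA[of "t + 1"] by (simp add: add.assoc)
  \<comment> \<open>Writing \<open>v t\<close> also as a polynomial in three consecutive values of
    \<open>A\<close> produces a common factor \<open>A (t + 1)\<close>; cancelling it leaves the
    continuant of these values.\<close>
  have "A (t + 1) * u (t + 4) = v t" unfolding A using nz by (simp add: add.commute)
  also have "\<dots> = (A t * A (t + 1) - 1) * (A (t + 1) * A (t + 2) - 1) - 1"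
    using uv(1)[of t] unfolding AA AA' by simp
  finally have "A (t + 1) * u (t + 4)
      = A (t + 1) * (A t * A (t + 1) * A (t + 2) - A t - A (t + 2))"
    by (simp add: algebra_simps)
  then have *: "u (t + 4) = A t * A (t + 1) * A (t + 2) - A t - A (t + 2)" using nz by simp
  show "A t + u (t + 4) = A (t + 2) * u t"
    using * unfolding AA by (simp add: algebra_simps)
  show "A (t + 2) + u (t + 4) = A t * u (t + 1)"
    using * unfolding mult.assoc AA' by (simp add: algebra_simps)
qed

lemma quiddity_Ints:
  fixes u A :: "int \<Rightarrow> rat"
  assumes u: "\<And>t. u t \<in> \<int>" and per: "\<And>t. A (t + 7) = A t"
    and AA: "\<And>t. A t * A (t + 1) = 1 + u t"
    and rec: "\<And>t. A t + u (t + 4) = A (t + 2) * u t"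
  shows "A t \<in> \<int>"
proof -
  have "\<exists>\<alpha>\<in>\<int>. \<exists>\<beta>\<in>\<int>. A t = \<alpha> * A (t + 2 * int k) + \<beta>" for k
  proof (induction k)
    case 0
    show ?case by (intro bexI[of _ 1] bexI[of _ 0]) auto
  next
    case (Suc k)
    then obtain \<alpha> \<beta> where ab: "\<alpha> \<in> \<int>" "\<beta> \<in> \<int>" and At: "A t = \<alpha> * A (t + 2 * int k) + \<beta>"
      by blast
    let ?w = "t + 2 * int k"
    have "A ?w = u ?w * A (t + 2 * int (Suc k)) - u (?w + 4)"
      using rec[of ?w] by (simp add: algebra_simps)
    then have "A t = \<alpha> * (u ?w * A (t + 2 * int (Suc k)) - u (?w + 4)) + \<beta>"
      using At by (simp only:)
    then have "A t = (\<alpha> * u ?w) * A (t + 2 * int (Suc k)) + (\<beta> - \<alpha> * u (?w + 4))"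
      by (simp add: algebra_simps)
    with ab u show ?case by (blast intro: Ints_mult Ints_diff)
  qed
  \<comment> \<open>Four steps of length 2 reach \<open>t + 8\<close>, which periodicity identifies
    with \<open>t + 1\<close>.\<close>
  from this[of 4] obtain \<alpha> \<beta> where ab: "\<alpha> \<in> \<int>" "\<beta> \<in> \<int>" and "A t = \<alpha> * A (t + 8) + \<beta>"
    by auto
  with per[of "t + 1"] have "A t = \<alpha> * A (t + 1) + \<beta>" by (simp add: add.assoc)
  then have "A t * A t = \<beta> * A t + \<alpha> * (1 + u t)"
    unfolding AA[symmetric] by (simp add: algebra_simps)
  moreover have "\<alpha> * (1 + u t) \<in> \<int>" by (intro Ints_mult Ints_add Ints_1 ab u)
  ultimately show ?thesis using Ints_if_monic_quadratic_root ab(2) by blast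
qed

text \<open>The chain is \<open>A 0\<close>, \<open>y 1 0\<close>, \<open>y 1 4\<close>,
  \<open>A 5\<close>, and its divisibility quotients are \<open>A 1\<close> to \<open>A 4\<close>.
  Consecutive quotients multiply to \<open>1 + y 1 t\<close>, so the chain also determines
  \<open>y 1 1\<close>, \<open>y 1 2\<close>, \<open>y 1 3\<close>.\<close>

lemma arithmetic_Y_frieze_pattern_4_imp_divisor_chain:
  assumes "arithmetic_Y_frieze_pattern 4 y"
  obtains p q r s :: int
  where "p > 0" "q > 0" "r > 0" "s > 0"
    "p dvd 1 + q" "q dvd p + r" "r dvd q + s" "s dvd r + 1"
    "y 1 0 = of_int q" "y 1 4 = of_int r"
    "y 1 1 = (1 + of_int q) / of_int p * ((of_int p + of_int r) / of_int q) - 1"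
    "y 1 2 = (of_int p + of_int r) / of_int q * ((of_int q + of_int s) / of_int r) - 1"
    "y 1 3 = (of_int q + of_int s) / of_int r * ((of_int r + 1) / of_int s) - 1"
    "y 3 0 = of_int s * y 1 1" "y 3 2 = of_int p * y 1 3"
proof -
  note rows = arithmetic_Y_frieze_pattern_4_first_rows[OF assms]
  define A where "A t = y 2 (t - 1) / y 1 (t + 3)" for t
  note quid = quiddity_relations[of "y 1" "y 2" A, OF rows(1,2,6,7) A_def]
  have per: "A (t + 7) = A t" for t
    using rows(3)[of "t + 3"] rows(4)[of "t - 1"] by (simp add: A_def add.assoc add.commute)
  have int: "A t \<in> \<int>" for t
    by (rule quiddity_Ints[of "y 1" A, OF rows(5) per quid(1,2)])
  have pos: "A t > 0" for t using rows(6,7) by (simp add: A_def)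
  define B where "B t = \<lfloor>A t\<rfloor>" for t
  define U where "U t = \<lfloor>y 1 t\<rfloor>" for t
  have B: "A t = of_int (B t)" and U: "y 1 t = of_int (U t)" for t
    using int rows(5) by (simp_all add: B_def U_def)
  have Bpos: "B t > 0" and Upos: "U t > 0" for t
    using pos[of t] rows(6)[of t] unfolding B U by simp_all
  have nz: "A t \<noteq> 0" "y 1 t \<noteq> 0" for t using pos[of t] rows(6)[of t] by auto
  have e1: "A 0 * A 1 = 1 + y 1 0" using quid(1)[of 0] by simp
  have e2: "A 2 * y 1 0 = A 0 + y 1 4" using quid(2)[of 0] by simp
  have e3: "A 3 * y 1 4 = y 1 0 + A 5" using quid(3)[of 3] rows(3)[of 0] by simp
  have e4: "A 4 * A 5 = y 1 4 + 1" using quid(1)[of 4] by simp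
  have "rat_of_int (1 + U 0) = of_int (B 0 * B 1)"
    and "rat_of_int (B 0 + U 4) = of_int (U 0 * B 2)"
    and "rat_of_int (U 0 + B 5) = of_int (U 4 * B 3)"
    and "rat_of_int (U 4 + 1) = of_int (B 5 * B 4)"
    using e1 e2 e3 e4 unfolding B U of_int_add of_int_mult of_int_1 by (simp_all only: mult.commute)
  then have d: "B 0 dvd 1 + U 0" "U 0 dvd B 0 + U 4" "U 4 dvd U 0 + B 5" "B 5 dvd U 4 + 1"
    unfolding of_int_eq_iff by - (rule dvdI, assumption)+
  have A1: "A 1 = (1 + of_int (U 0)) / of_int (B 0)"
    using e1 nz(1)[of 0] unfolding B[of 0, symmetric] U[symmetric] by (simp add: field_simps)
  have A2: "A 2 = (of_int (B 0) + of_int (U 4)) / of_int (U 0)"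
    using e2 nz(2)[of 0] unfolding B[of 0, symmetric] U[symmetric] by (simp add: field_simps)
  have A3: "A 3 = (of_int (U 0) + of_int (B 5)) / of_int (U 4)"
    using e3 nz(2)[of 4] unfolding B[of 5, symmetric] U[symmetric] by (simp add: field_simps)
  have A4: "A 4 = (of_int (U 4) + 1) / of_int (B 5)"
    using e4 nz(1)[of 5] unfolding B[of 5, symmetric] U[symmetric] by (simp add: field_simps)
  have u: "y 1 1 = A 1 * A 2 - 1" "y 1 2 = A 2 * A 3 - 1" "y 1 3 = A 3 * A 4 - 1"
    using quid(1)[of 1] quid(1)[of 2] quid(1)[of 3] by simp_all
  \<comment> \<open>These are the definitions of \<open>A 5\<close> and \<open>A 7 = A 0\<close>,
    read through the glide and the period.\<close>
  have y3: "y 3 0 = of_int (B 5) * y 1 1" "y 3 2 = of_int (B 0) * y 1 3"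
    using glide_symmetry(3)[OF assms, of 0] glide_symmetry(3)[OF assms, of 2]
      rows(3)[of 1] rows(3)[of 3] per[of 0] nz(2)[of 1] nz(2)[of 3]
    unfolding B[symmetric] by (simp_all add: A_def)
  show ?thesis
    by (rule that[OF Bpos Upos Upos Bpos d U U _ _ _ y3]) (simp_all only: u A1 A2 A3 A4)
qed

section \<open>Classification of the fundamental domains\<close>

theorem theorem3p7:
  fixes a b c d e f g h i j k l m n :: rat
  shows "(\<exists>y. arithmetic_Y_frieze_pattern 4 y \<and>
            (a, b, c, d, e, f, g, h, i, j, k, l, m, n) =
            (y 1 0, y 2 0, y 3 0, y 4 0, y 1 1, y 2 1, y 3 1, y 4 1,
             y 1 2, y 2 2, y 3 2, y 1 3, y 2 3, y 1 4))
     \<longleftrightarrow> (a, b, c, d, e, f, g, h, i, j, k, l, m, n) \<in>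
      {(1, 1, 2, 3, 2, 9, 20, 7, 5, 14, 6, 3, 2, 1),
       (1, 1, 4, 5, 2, 15, 24, 5, 8, 15, 4, 2, 1, 1),
       (1, 2, 3, 2, 3, 8, 9, 5, 3, 5, 4, 2, 3, 2),
       (1, 2, 3, 4, 3, 8, 15, 4, 3, 8, 3, 3, 2, 1),
       (1, 2, 6, 7, 3, 14, 20, 3, 5, 9, 2, 2, 1, 1),
       (1, 2, 9, 5, 3, 20, 14, 3, 7, 6, 2, 1, 1, 2),
       (1, 3, 8, 3, 4, 15, 8, 3, 4, 3, 2, 1, 2, 3),
       (1, 4, 5, 3, 5, 9, 8, 3, 2, 3, 2, 2, 3, 2),
       (1, 4, 15, 8, 5, 24, 15, 2, 5, 4, 1, 1, 1, 2),
       (1, 6, 14, 5, 7, 20, 9, 2, 3, 2, 1, 1, 2, 3),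
       (2, 1, 1, 2, 1, 4, 15, 8, 5, 24, 15, 5, 4, 1),
       (2, 1, 2, 3, 1, 6, 14, 5, 7, 20, 9, 3, 2, 1),
       (2, 3, 2, 1, 2, 3, 4, 5, 2, 5, 9, 3, 8, 3),
       (2, 3, 2, 3, 2, 3, 8, 3, 2, 9, 5, 5, 4, 1),
       (2, 3, 4, 5, 2, 5, 9, 2, 3, 8, 3, 3, 2, 1),
       (2, 3, 8, 3, 2, 9, 5, 2, 5, 4, 3, 1, 2, 3),
       (2, 5, 9, 2, 3, 8, 3, 2, 3, 2, 3, 1, 4, 5),
       (2, 9, 5, 2, 5, 4, 3, 2, 1, 2, 3, 3, 8, 3),
       (2, 9, 20, 7, 5, 14, 6, 1, 3, 2, 1, 1, 2, 3),
       (2, 15, 24, 5, 8, 15, 4, 1, 2, 1, 1, 1, 4, 5),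
       (3, 2, 1, 1, 1, 2, 6, 7, 3, 14, 20, 5, 9, 2),
       (3, 2, 1, 2, 1, 2, 9, 5, 3, 20, 14, 7, 6, 1),
       (3, 2, 2, 3, 1, 3, 8, 3, 4, 15, 8, 4, 3, 1),
       (3, 2, 3, 2, 1, 4, 5, 3, 5, 9, 8, 2, 3, 2),
       (3, 5, 4, 1, 2, 3, 2, 3, 2, 3, 8, 2, 9, 5),
       (3, 8, 3, 1, 3, 2, 2, 3, 1, 3, 8, 4, 15, 4),
       (3, 8, 3, 2, 3, 2, 3, 2, 1, 4, 5, 5, 9, 2),
       (3, 8, 9, 5, 3, 5, 4, 1, 2, 3, 2, 2, 3, 2),
       (3, 8, 15, 4, 3, 8, 3, 1, 3, 2, 2, 1, 3, 4),
       (3, 14, 20, 3, 5, 9, 2, 1, 2, 1, 2, 1, 6, 7),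
       (3, 20, 14, 3, 7, 6, 2, 1, 1, 1, 2, 2, 9, 5),
       (4, 3, 2, 1, 1, 2, 3, 4, 3, 8, 15, 3, 8, 3),
       (4, 15, 8, 3, 4, 3, 2, 1, 1, 2, 3, 3, 8, 3),
       (5, 4, 1, 1, 1, 1, 4, 5, 2, 15, 24, 8, 15, 2),
       (5, 4, 3, 2, 1, 2, 3, 2, 3, 8, 9, 3, 5, 2),
       (5, 9, 2, 1, 2, 1, 2, 3, 1, 6, 14, 7, 20, 3),
       (5, 9, 8, 3, 2, 3, 2, 1, 2, 3, 4, 2, 5, 3),
       (5, 14, 6, 1, 3, 2, 1, 2, 1, 2, 9, 3, 20, 7),
       (5, 24, 15, 2, 5, 4, 1, 1, 1, 1, 4, 2, 15, 8),
       (7, 6, 2, 1, 1, 1, 2, 3, 2, 9, 20, 5, 14, 3),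
       (7, 20, 9, 2, 3, 2, 1, 1, 1, 2, 6, 3, 14, 5),
       (8, 15, 4, 1, 2, 1, 1, 2, 1, 4, 15, 5, 24, 5)}"
  (is "?L \<longleftrightarrow> ?R")
proof
  assume ?L
  then obtain y where y: "arithmetic_Y_frieze_pattern 4 y"
    and eq: "(a, b, c, d, e, f, g, h, i, j, k, l, m, n) =
            (y 1 0, y 2 0, y 3 0, y 4 0, y 1 1, y 2 1, y 3 1, y 4 1,
             y 1 2, y 2 2, y 3 2, y 1 3, y 2 3, y 1 4)"
    by blast
  note rows = arithmetic_Y_frieze_pattern_4_first_rows[OF y]
  from y obtain p q r s :: int where chain: "p > 0" "q > 0" "r > 0" "s > 0"
      "p dvd 1 + q" "q dvd p + r" "r dvd q + s" "s dvd r + 1"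
    and a: "a = of_int q" and n: "n = of_int r"
    and e: "e = (1 + of_int q) / of_int p * ((of_int p + of_int r) / of_int q) - 1"
    and i: "i = (of_int p + of_int r) / of_int q * ((of_int q + of_int s) / of_int r) - 1"
    and l: "l = (of_int q + of_int s) / of_int r * ((of_int r + 1) / of_int s) - 1"
    and c: "c = of_int s * e" and k: "k = of_int p * l"
    using eq by (elim arithmetic_Y_frieze_pattern_4_imp_divisor_chain) simp
  have v: "b = a * e - 1" "f = e * i - 1" "j = i * l - 1" "m = l * n - 1"
    using rows(1)[of 0] rows(1)[of 1] rows(1)[of 2] rows(1)[of 3] eq by simp_all
  \<comment> \<open>The first-row relations at positions 4, 5, 6 wrap around the period and yield
    \<open>d\<close>, \<open>h\<close>, \<open>g\<close>, so the chain now fixes the whole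
    tuple.\<close>
  have "n * d = 1 + c" "d * h = 1 + g" "a * h = 1 + k"
    using rows(1)[of 4] rows(1)[of 5] rows(1)[of 6] rows(3)[of 0]
      glide_symmetry(3)[OF y, of 0] glide_symmetry(3)[OF y, of 1] glide_symmetry(3)[OF y, of 2]
      glide_symmetry(4)[OF y, of 0] glide_symmetry(4)[OF y, of 1] eq by (simp_all add: mult.commute)
  moreover have "n \<noteq> 0" "a \<noteq> 0" using chain a n by auto
  ultimately have d: "d = (1 + c) / n" and h: "h = (1 + k) / a" and g: "g = d * h - 1"
    by (simp_all add: field_simps)
  show ?R
    \<comment> \<open>For each chain, \<open>eq_mem_trans\<close> introduces an unknown tuple that
      simplification fills with the computed numbers before its place in the list is
      searched.\<close>
    using divisor_chain_4[OF chain]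
    by (elim insertE emptyE Pair_inject)
      ((rule eq_mem_trans, simp add: a n e i l c k v d h g, (rule insertI1 | rule insertI2)+) [])+
next
  assume ?R
  then show ?L
    \<comment> \<open>Each listed tuple is verified by evaluating the relations over one
      period.\<close>
    by (elim insertE emptyE Pair_inject)
      ((hypsubst, rule arithmetic_Y_frieze_pattern_4_exI; simp) [])+
qed

end
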